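(* Let $h_1,\dots,h_m$ be real polynomials in $\tilde{\mathbf{x}}=[\mathbf{x}^\top\ \mathbf{x}_-^\top]^\top\in\mathbb{R}^{2n}$ (with $\mathbf{x},\mathbf{x}_-\in\mathbb{R}^n$), let $\tilde{\mathcal{X}}=\{\tilde{\mathbf{x}}\in\mathbb{R}^{2n}:\ h_s(\tilde{\mathbf{x}})\le 0,\ s=1,\dots,m\}$, and let $\mathcal{X}\subset\mathbb{R}^n$ be the projection of $\tilde{\mathcal{X}}$ onto the $\mathbf{x}$-coordinates, assumed compact. Let $\boldsymbol{\omega}\in\mathbb{R}^n$, let $\mathbf{d}\ge 1$ be an integer, and let $$\nu^{**}=\inf_{\nu,\sigma_0,\dots,\sigma_m}\ \nu\quad\text{s.t.}\quad \nu-\boldsymbol{\omega}^\top\mathbf{x}=\sigma_0(\tilde{\mathbf{x}})-\sum_{s=1}^m\sigma_s(\tilde{\mathbf{x}})h_s(\tilde{\mathbf{x}})\ \ \forall\,\tilde{\mathbf{x}}\in\mathbb{R}^{2n},\quad \sigma_0,\dots,\sigma_m\in\Sigma_{2\mathbf{d}}[\tilde{\mathbf{x}}],$$ with $\nu\in\mathbb{R}$. Then the set $$\mathcal{M}=\left\{\int\mathbf{x}\,dP(\mathbf{x}):\ P\text{ a Borel probability measure on }\mathbb{R}^n\text{ with }\int_{\mathcal{X}}dP=1\right\}$$ is contained in the half-space $\mathcal{H}=\{\boldsymbol{\rho}\in\mathbb{R}^n:\ \boldsymbol{\omega}^\top\boldsymbol{\rho}\le\nu^{**}\}$, i.e. 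$\mathcal{M}\subseteq\mathcal{H}$.
   Context: $\Sigma_{2\mathbf{d}}[\tilde{\mathbf{x}}]$ is the set of sum-of-squares polynomials in $\tilde{\mathbf{x}}$ of degree at most $2\mathbf{d}$, i.e. polynomials of the form $\sigma(\tilde{\mathbf{x}})=\mathbf{q}_{\mathbf{d}}(\tilde{\mathbf{x}})^\top\mathbf{Q}\,\mathbf{q}_{\mathbf{d}}(\tilde{\mathbf{x}})$, where $\mathbf{q}_{\mathbf{d}}(\tilde{\mathbf{x}})$ is the vector of all monomials in $\tilde{\mathbf{x}}$ of degree at most $\mathbf{d}$ and $\mathbf{Q}$ is a real symmetric positive semidefinite matrix of size $\binom{2n+\mathbf{d}}{\mathbf{d}}$. The infimum over an empty feasible set is $+\infty$ (in which case $\mathcal{H}=\mathbb{R}^n$). *)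

theory Defs
  imports "HOL-Probability.Probability"
begin

text \<open>
  A point of $\mathbb{R}^{2n}$ is a vector indexed by the type \<^typ>\<open>'n + 'n\<close>: the
  \<^const>\<open>Inl\<close> coordinates are $x$ and the \<^const>\<open>Inr\<close> coordinates are $x_-$.
\<close>

definition proj_x :: "real ^ ('n::finite + 'n) \<Rightarrow> real ^ 'n" where
  "proj_x z = (\<chi> i. z $ Inl i)"

definition exponents :: "nat \<Rightarrow> ('k::finite \<Rightarrow> nat) set" where
  "exponents d = {\<alpha>. (\<Sum>i\<in>UNIV. \<alpha> i) \<le> d}"

text \<open>The sums over \<open>exponents d\<close> below are genuine finite sums.\<close>

lemma finite_exponents: "finite (exponents d :: ('k::finite \<Rightarrow> nat) set)"
proof (rule finite_subset)
  show "exponents d \<subseteq> (UNIV :: 'k set) \<rightarrow>\<^sub>E {..d}"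
  proof
    fix \<alpha> :: "'k \<Rightarrow> nat" assume \<alpha>: "\<alpha> \<in> exponents d"
    have "\<alpha> i \<le> d" for i
      using member_le_sum[of i UNIV \<alpha>] \<alpha> by (auto simp: exponents_def)
    then show "\<alpha> \<in> (UNIV :: 'k set) \<rightarrow>\<^sub>E {..d}" by auto
  qed
  show "finite ((UNIV :: 'k set) \<rightarrow>\<^sub>E {..d})" by (intro finite_PiE) auto
qed

definition monom_fun :: "('k::finite \<Rightarrow> nat) \<Rightarrow> real ^ 'k \<Rightarrow> real" where
  "monom_fun \<alpha> z = (\<Prod>i\<in>UNIV. (z $ i) ^ \<alpha> i)"

definition sym_on :: "'i set \<Rightarrow> ('i \<Rightarrow> 'i \<Rightarrow> real) \<Rightarrow> bool" where
  "sym_on I Q \<longleftrightarrow> (\<forall>a\<in>I. \<forall>b\<in>I. Q a b = Q b a)"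

definition psd_on :: "'i set \<Rightarrow> ('i \<Rightarrow> 'i \<Rightarrow> real) \<Rightarrow> bool" where
  "psd_on I Q \<longleftrightarrow> (\<forall>v. 0 \<le> (\<Sum>a\<in>I. \<Sum>b\<in>I. v a * Q a b * v b))"

text \<open>
  \<open>sos d\<close> is $\Sigma_{2d}$: the polynomial functions $q_d^\top Q\, q_d$, where the entries of
  $q_d$ and the rows and columns of the Gram matrix $Q$ are indexed directly by the exponent
  vectors of total degree at most $d$, of which there are $\binom{2n+d}{d}$ in $2n$ variables.
  Entries of \<open>Q\<close> outside the index set are irrelevant.
\<close>

definition sos :: "nat \<Rightarrow> (real ^ 'k::finite \<Rightarrow> real) set" where
  "sos d = {\<sigma>. \<exists>Q. sym_on (exponents d) Q \<and> psd_on (exponents d) Q \<and>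
     (\<forall>z. \<sigma> z = (\<Sum>\<alpha>\<in>exponents d. \<Sum>\<beta>\<in>exponents d. monom_fun \<alpha> z * Q \<alpha> \<beta> * monom_fun \<beta> z))}"

definition lifted_set :: "nat \<Rightarrow> (nat \<Rightarrow> real ^ ('n::finite + 'n) \<Rightarrow> real) \<Rightarrow> (real ^ ('n + 'n)) set"
  where "lifted_set m h = {z. \<forall>s\<in>{1..m}. h s z \<le> 0}"

definition projected_set :: "nat \<Rightarrow> (nat \<Rightarrow> real ^ ('n::finite + 'n) \<Rightarrow> real) \<Rightarrow> (real ^ 'n) set"
  where "projected_set m h = proj_x ` lifted_set m h"

definition sos_feasible ::
  "nat \<Rightarrow> (nat \<Rightarrow> real ^ ('n::finite + 'n) \<Rightarrow> real) \<Rightarrow> real ^ 'n \<Rightarrow> nat \<Rightarrow> real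
    \<Rightarrow> (nat \<Rightarrow> real ^ ('n + 'n) \<Rightarrow> real) \<Rightarrow> bool" where
  "sos_feasible m h \<omega> d \<nu> \<sigma> \<longleftrightarrow>
     (\<forall>s\<in>{0..m}. \<sigma> s \<in> sos d) \<and>
     (\<forall>z. \<nu> - \<omega> \<bullet> proj_x z = \<sigma> 0 z - (\<Sum>s=1..m. \<sigma> s z * h s z))"

text \<open>The infimum is taken in \<^typ>\<open>ereal\<close>, so that it is \<open>\<infinity>\<close> when nothing is feasible.\<close>

definition sos_bound ::
  "nat \<Rightarrow> (nat \<Rightarrow> real ^ ('n::finite + 'n) \<Rightarrow> real) \<Rightarrow> real ^ 'n \<Rightarrow> nat \<Rightarrow> ereal" where
  "sos_bound m h \<omega> d = Inf {ereal \<nu> | \<nu> \<sigma>. sos_feasible m h \<omega> d \<nu> \<sigma>}"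

text \<open>
  For compact \<open>X\<close> the identity is bounded almost everywhere, so every mean below is the integral
  of an integrable function.
\<close>

definition mean_set :: "(real ^ 'n::finite) set \<Rightarrow> (real ^ 'n) set" where
  "mean_set X = {integral\<^sup>L P (\<lambda>x. x) | P :: (real ^ 'n) measure.
     prob_space P \<and> sets P = sets borel \<and> (LINT x:X|P. (1::real)) = 1}"

definition halfspace_le :: "real ^ 'n::finite \<Rightarrow> ereal \<Rightarrow> (real ^ 'n) set" where
  "halfspace_le \<omega> c = {\<rho>. ereal (\<omega> \<bullet> \<rho>) \<le> c}"

end

theory Submission
  imports Defs
begin

text \<open>This is weak duality for sum-of-squares certificates. At a point of the lifted set every
  \<open>h s\<close> is nonpositive and every multiplier is nonnegative, so the certificate identity
  forces \<open>\<omega> \<bullet> x \<le> \<nu>\<close> on the projection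
  (\<open>sos_feasible_bound\<close>). A linear bound on a compact set passes to the mean of any
  probability measure concentrated there (\<open>mean_set_inner_le\<close>). Every feasible
  \<open>\<nu>\<close> thus bounds \<open>\<omega> \<bullet> \<rho>\<close>, and so does their
  infimum.\<close>

lemma sos_nonneg:
  assumes "\<sigma> \<in> sos d"
  shows "0 \<le> \<sigma> z"
proof -
  obtain Q where Q: "psd_on (exponents d) Q" and
    \<sigma>: "\<sigma> z = (\<Sum>\<alpha>\<in>exponents d. \<Sum>\<beta>\<in>exponents d. monom_fun \<alpha> z * Q \<alpha> \<beta> * monom_fun \<beta> z)"
    using assms by (auto simp: sos_def)
  show ?thesis
    unfolding \<sigma> using Q[unfolded psd_on_def, rule_format, of "\<lambda>\<alpha>. monom_fun \<alpha> z"] .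
qed

text \<open>The identity holds on the whole lifted space, so it may be evaluated at any preimage
  \<open>z\<close> of \<open>x\<close>; its left side depends on \<open>z\<close> only through
  \<open>x\<close>.\<close>

lemma sos_feasible_bound:
  assumes "sos_feasible m h \<omega> d \<nu> \<sigma>" and "x \<in> projected_set m h"
  shows "\<omega> \<bullet> x \<le> \<nu>"
proof -
  obtain z where x: "x = proj_x z" and z: "\<And>s. s \<in> {1..m} \<Longrightarrow> h s z \<le> 0"
    using assms(2) by (auto simp: projected_set_def lifted_set_def)
  have \<sigma>: "0 \<le> \<sigma> s z" if "s \<in> {0..m}" for s
    using assms(1) that by (auto simp: sos_feasible_def intro: sos_nonneg)
  have "(\<Sum>s=1..m. \<sigma> s z * h s z) \<le> 0"
    using \<sigma> z by (intro sum_nonpos mult_nonneg_nonpos) auto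
  moreover have "\<nu> - \<omega> \<bullet> x = \<sigma> 0 z - (\<Sum>s=1..m. \<sigma> s z * h s z)"
    using assms(1) unfolding x sos_feasible_def by blast
  ultimately show ?thesis
    using \<sigma>[of 0] by simp
qed

text \<open>Compactness serves twice: \<open>X\<close> is closed, hence Borel, and bounded, hence
  the identity is integrable. Integrability lets the inner product move inside the integral, which
  would otherwise take the default value 0.\<close>

lemma mean_set_inner_le:
  fixes X :: "(real ^ 'n::finite) set"
  assumes "compact X" and \<rho>: "\<rho> \<in> mean_set X"
    and bound: "\<And>x. x \<in> X \<Longrightarrow> \<omega> \<bullet> x \<le> \<nu>"
  shows "\<omega> \<bullet> \<rho> \<le> \<nu>"
proof -
  obtain P where "prob_space P" and sets_P [measurable_cong]: "sets P = sets borel"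
    and mass: "(LINT x:X|P. (1::real)) = 1" and \<rho>_eq: "\<rho> = integral\<^sup>L P (\<lambda>x. x)"
    using \<rho> by (auto simp: mean_set_def)
  interpret prob_space P by fact
  have X: "X \<in> sets P"
    using \<open>compact X\<close> sets_P by (simp add: borel_compact)
  \<comment> \<open>The set integral of 1 is the integral of the indicator of \<open>X\<close>, that
    is, the measure of \<open>X\<close>.\<close>
  have "prob X = 1"
    using mass X sets.sets_into_space[OF X]
    by (simp add: set_lebesgue_integral_def Int_absorb2)
  then have in_X: "AE x in P. x \<in> X"
    using prob_eq_1[OF X] by simp
  obtain B where B: "\<And>x. x \<in> X \<Longrightarrow> norm x \<le> B"
    using compact_imp_bounded[OF \<open>compact X\<close>] by (auto simp: bounded_iff)
  have int: "integrable P (\<lambda>x. x)"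
  proof (rule integrable_const_bound[where B = B])
    show "AE x in P. norm x \<le> B"
      using in_X by eventually_elim (rule B)
  qed measurable
  have "\<omega> \<bullet> \<rho> = (LINT x|P. \<omega> \<bullet> x)"
    unfolding \<rho>_eq using int by simp
  also have "\<dots> \<le> (LINT x|P. \<nu>)"
  proof (rule integral_mono_AE)
    show "AE x in P. \<omega> \<bullet> x \<le> \<nu>"
      using in_X by eventually_elim (rule bound)
  qed (use int in auto)
  also have "\<dots> = \<nu>"
    by (simp add: prob_space)
  finally show ?thesis .
qed

theorem corollary1:
  fixes h :: "nat \<Rightarrow> real ^ ('n::finite + 'n) \<Rightarrow> real"
    and \<omega> :: "real ^ 'n"
    and m d :: nat
  assumes "\<And>s. s \<in> {1..m} \<Longrightarrow> real_polynomial_function (h s)"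
    and "compact (projected_set m h)"
    and "d \<ge> 1"
  shows "mean_set (projected_set m h) \<subseteq> halfspace_le \<omega> (sos_bound m h \<omega> d)"
proof
  fix \<rho> assume \<rho>: "\<rho> \<in> mean_set (projected_set m h)"
  have "\<omega> \<bullet> \<rho> \<le> \<nu>" if "sos_feasible m h \<omega> d \<nu> \<sigma>" for \<nu> \<sigma>
    using mean_set_inner_le[OF assms(2) \<rho>] sos_feasible_bound[OF that] by blast
  \<comment> \<open>\<open>Inf_greatest\<close> also covers the infeasible case, where the infimum
    in \<open>ereal\<close> is infinite, so no case split is needed.\<close>
  then show "\<rho> \<in> halfspace_le \<omega> (sos_bound m h \<omega> d)"
    by (auto simp: halfspace_le_def sos_bound_def intro!: Inf_greatest)
qed

end
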